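(* Fix an integer $d\ge 1$. Let $\alpha$ be a positive real number less than $1$. There exists an almost periodic $d$-dimensional sequence $\omega\colon\mathbb{Z}^d\to\{0,1\}$ such that any sufficiently large subcube $x$ of $\omega$ has large complexity: there is a number $N$ such that every subcube $x$ of $\omega$ with side greater than $N$ satisfies $$\mathrm{K}(x)\ge\alpha\cdot\mathrm{volume}(x).$$
   Context: A $d$-dimensional sequence is a function $\omega\colon\mathbb{Z}^d\to\{0,1\}$. A subcube of $\omega$ with side $k$ is the restriction of $\omega$ to a set $[m_1,m_1+k)\times\cdots\times[m_d,m_d+k)\subset\mathbb{Z}^d$ with $m_1,\ldots,m_d\in\mathbb{Z}$, regarded up to translation, i.e. as a function $x\colon\{0,\ldots,k-1\}^d\to\{0,1\}$. Its volume is the number of points, $\mathrm{volume}(x)=k^d$. The sequence $\omega$ is almost periodic if for any cube $x$ that appears in $\omega$ (as a subcube) there exists a number $k$ such that any subcube of $\omega$ with side $k$ contains (a translated copy of) $x$ inside. $\mathrm{K}(x)$ is the Kolmogorov complexity of the finite object $x$ (under a fixed computable encoding of binary cubes by binary strings), i.e. the length of a shortest program producing $x$ with respect to a fixed optimal (universal) machine; it does not matter which version (plain, prefix, etc.) is used. *)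

theory Defs
  imports "HOL-Library.Extended_Real" "HOL-Library.FuncSet"
begin

section \<open>Partial computable functions on binary strings\<close>

text \<open>
  Partial recursive functions. Arguments are passed as lists of arbitrary length;
  a term is simply undefined on argument lists of unsuitable length.
\<close>

datatype recf =
    Zero
  | Succ
  | Proj nat
  | Comp recf "recf list"
  | PrimRec recf recf
  | Mu recf

inductive computes :: "recf \<Rightarrow> nat list \<Rightarrow> nat \<Rightarrow> bool" where
  zero: "computes Zero xs 0"
| succ: "computes Succ [x] (Suc x)"
| proj: "i < length xs \<Longrightarrow> computes (Proj i) xs (xs ! i)"
| comp: "list_all2 (\<lambda>g y. computes g xs y) gs ys \<Longrightarrow> computes f ys z \<Longrightarrow>
    computes (Comp f gs) xs z"
| prim_0: "computes f xs z \<Longrightarrow> computes (PrimRec f g) (0 # xs) z"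
| prim_Suc: "computes (PrimRec f g) (n # xs) y \<Longrightarrow> computes g (n # y # xs) z \<Longrightarrow>
    computes (PrimRec f g) (Suc n # xs) z"
| mu: "computes f (n # xs) 0 \<Longrightarrow> (\<forall>i<n. \<exists>y. computes f (i # xs) (Suc y)) \<Longrightarrow>
    computes (Mu f) xs n"

inductive_cases computesE:
  "computes Zero xs z"
  "computes Succ xs z"
  "computes (Proj i) xs z"
  "computes (PrimRec f g) (0 # xs) z"

inductive_cases computes_CompE: "computes (Comp f gs) xs z"
inductive_cases computes_PrimSucE: "computes (PrimRec f g) (Suc n # xs) z"
inductive_cases computes_MuE: "computes (Mu f) xs z"

lemma computes_deterministic: "computes f xs y \<Longrightarrow> computes f xs z \<Longrightarrow> y = z"
proof (induction f xs y arbitrary: z rule: computes.induct)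
  case (comp xs gs ys f z z')
  from comp.prems obtain ys' where *: "list_all2 (\<lambda>g y. computes g xs y) gs ys'"
    "computes f ys' z'" by (rule computes_CompE)
  have "ys = ys'"
  proof (rule nth_equalityI)
    show len: "length ys = length ys'"
      using list_all2_lengthD[OF comp.IH(1)] list_all2_lengthD[OF *(1)] by simp
    fix i assume i: "i < length ys"
    then have "computes (gs ! i) xs (ys' ! i)"
      using *(1) len by (simp add: list_all2_conv_all_nth)
    with list_all2_nthD2[OF comp.IH(1) i] show "ys ! i = ys' ! i" by blast
  qed
  with *(2) have "computes f ys z'" by simp
  then show ?case by (rule comp.IH(2))
next
  case (prim_Suc f g n xs y z z')
  from prim_Suc.prems obtain y' where "computes (PrimRec f g) (n # xs) y'"
    and "computes g (n # y' # xs) z'" by (rule computes_PrimSucE)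
  with prim_Suc.IH(1) have "computes g (n # y # xs) z'" by blast
  then show ?case by (rule prim_Suc.IH(2))
next
  case (mu f n xs m)
  from mu.prems have *: "computes f (m # xs) 0" "\<And>i. i < m \<Longrightarrow> \<exists>y. computes f (i # xs) (Suc y)"
    by (rule computes_MuE; blast)+
  show ?case
  proof (cases n m rule: linorder_cases)
    case less
    from *(2)[OF this] obtain y where "computes f (n # xs) (Suc y)" by blast
    then have "0 = Suc y" by (rule mu.IH(1))
    then show ?thesis by simp
  next
    case greater
    from mu.IH(2)[rule_format, OF this] obtain y where
      "\<forall>z. computes f (m # xs) z \<longrightarrow> Suc y = z" by blast
    with *(1) have "Suc y = 0" by blast
    then show ?thesis by simp
  qed
next
  case (prim_0 f xs y g z)
  from prim_0.prems have "computes f xs z" by (rule computesE)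
  then show ?case by (rule prim_0.IH)
qed (erule computesE; simp)+

text \<open>Bijective base-2 numeration, least significant digit first.\<close>

fun string_code :: "bool list \<Rightarrow> nat" where
  "string_code [] = 0"
| "string_code (b # bs) = 2 * string_code bs + (if b then 2 else 1)"

lemma bij_string_code: "bij string_code"
proof (rule bijI)
  have "string_code p = string_code q \<Longrightarrow> p = q" for p q
  proof (induction p arbitrary: q)
    case Nil
    then show ?case by (cases q) (auto split: if_splits)
  next
    case (Cons b p)
    show ?case
    proof (cases q)
      case Nil
      with Cons.prems show ?thesis by (auto split: if_splits)
    next
      case q: (Cons c q')
      have "b = c"
        using Cons.prems unfolding q by (cases b; cases c; simp; presburger)
      moreover from this Cons.prems have "string_code p = string_code q'"
        unfolding q by simp
      ultimately show ?thesis using Cons.IH q by blast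
    qed
  qed
  then show "inj string_code" by (auto intro: injI)
  have "\<exists>p. string_code p = n" for n
  proof (induction n rule: less_induct)
    case (less n)
    have "n = 0 \<or> n = 2 * ((n - 1) div 2) + 1 \<or> n = 2 * ((n - 1) div 2) + 2"
      by presburger
    then consider "n = 0" | k where "n = 2 * k + 1" | k where "n = 2 * k + 2"
      by blast
    then show ?case
    proof cases
      case 1 then show ?thesis by (intro exI[of _ "[]"]) simp
    next
      case 2
      with less[of k] obtain p where "string_code p = k" by auto
      with 2 show ?thesis by (intro exI[of _ "False # p"]) simp
    next
      case 3
      with less[of k] obtain p where "string_code p = k" by auto
      with 3 show ?thesis by (intro exI[of _ "True # p"]) simp
    qed
  qed
  then show "surj string_code" unfolding surj_def by metis
qed

definition partial_computable :: "(bool list \<Rightarrow> bool list option) \<Rightarrow> bool" where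
  "partial_computable f \<longleftrightarrow>
    (\<exists>r. \<forall>p q. f p = Some q \<longleftrightarrow> computes r [string_code p] (string_code q))"


section \<open>Plain Kolmogorov complexity\<close>

text \<open>The value is \<open>\<infinity>\<close> if no program produces \<open>x\<close>.\<close>

definition complexity :: "(bool list \<Rightarrow> bool list option) \<Rightarrow> bool list \<Rightarrow> enat" where
  "complexity U x = (INF p \<in> {p. U p = Some x}. enat (length p))"

definition optimal_machine :: "(bool list \<Rightarrow> bool list option) \<Rightarrow> bool" where
  "optimal_machine U \<longleftrightarrow> partial_computable U \<and>
    (\<forall>V. partial_computable V \<longrightarrow>
      (\<exists>c::nat. \<forall>x. complexity U x \<le> complexity V x + enat c))"


section \<open>Multidimensional sequences and their subcubes\<close>

text \<open>
  Points of \<open>\<int>\<^sup>d\<close> are integer lists of length \<open>d\<close>. A binary cube of side \<open>k\<close> is an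
  element of \<open>grid d k \<rightarrow>\<^sub>E UNIV\<close>.
\<close>

definition lattice_points :: "nat \<Rightarrow> int list set" where
  "lattice_points d = {p. length p = d}"

definition grid :: "nat \<Rightarrow> nat \<Rightarrow> nat list set" where
  "grid d k = {i. length i = d \<and> (\<forall>a \<in> set i. a < k)}"

definition subcube :: "nat \<Rightarrow> nat \<Rightarrow> (int list \<Rightarrow> bool) \<Rightarrow> int list \<Rightarrow> nat list \<Rightarrow> bool" where
  "subcube d k \<omega> m = (\<lambda>i \<in> grid d k. \<omega> (map2 (\<lambda>a b. a + int b) m i))"

text \<open>A cube \<open>x\<close> of side \<open>n\<close> occurs inside a cube \<open>y\<close> of side \<open>k\<close>, at offset \<open>s\<close>.\<close>

definition occurs_in :: "nat \<Rightarrow> nat \<Rightarrow> (nat list \<Rightarrow> bool) \<Rightarrow> nat \<Rightarrow> (nat list \<Rightarrow> bool) \<Rightarrow> bool" where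
  "occurs_in d n x k y \<longleftrightarrow>
    (\<exists>s. length s = d \<and> (\<forall>a \<in> set s. a + n \<le> k) \<and> (\<forall>i \<in> grid d n. x i = y (map2 (+) s i)))"

definition almost_periodic :: "nat \<Rightarrow> (int list \<Rightarrow> bool) \<Rightarrow> bool" where
  "almost_periodic d \<omega> \<longleftrightarrow>
    (\<forall>n x. (\<exists>m \<in> lattice_points d. x = subcube d n \<omega> m) \<longrightarrow>
      (\<exists>k. \<forall>m \<in> lattice_points d. occurs_in d n x k (subcube d k \<omega> m)))"

text \<open>
  The \<open>k ^ d\<close> bits of a cube in lexicographic order of the coordinates. For \<open>d \<ge> 1\<close> the
  side is determined by the length of the string.
\<close>

definition cube_string :: "nat \<Rightarrow> nat \<Rightarrow> (nat list \<Rightarrow> bool) \<Rightarrow> bool list" where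
  "cube_string d k x = map x (product_lists (replicate d [0..<k]))"

lemma set_product_lists_grid: "set (product_lists (replicate d [0..<k])) = grid d k"
  by (induction d) (auto simp: grid_def length_Suc_conv image_iff)

lemma length_cube_string: "length (cube_string d k x) = k ^ d"
  unfolding cube_string_def
  by (induction d) (simp_all add: length_concat comp_def sum_list_triv)

definition cube_complexity ::
  "(bool list \<Rightarrow> bool list option) \<Rightarrow> nat \<Rightarrow> nat \<Rightarrow> (nat list \<Rightarrow> bool) \<Rightarrow> enat" where
  "cube_complexity U d k x = complexity U (cube_string d k x)"

end

theory Submission imports Defs begin

text \<open>
  The proof is combinatorial: the only property of complexity used is that at most \<open>2 * 2 powr t\<close>
  strings have complexity below \<open>t\<close>. Regard the cubes of side \<open>k > N\<close> and complexity below
  \<open>\<alpha> * k ^ d\<close> as forbidden patterns. Rosenfeld's counting argument shows that each new point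
  of a finite region multiplies the number of admissible colourings by at least
  \<open>\<beta> = 2 powr ((1 + \<alpha>) / 2)\<close>, because a colouring spoilt by a forbidden cube \<open>C\<close> is determined
  by that pattern and by an admissible colouring of the region without \<open>C\<close>, of which there are fewer
  by a factor \<open>\<beta> ^ (k ^ d - 1)\<close>. Now enlarge the set of forbidden patterns to a maximal one that can
  still be avoided on all finite regions. By compactness some sequence avoids it everywhere. A pattern
  that occurs in this sequence cannot be added to the set, so it occurs in every admissible colouring of
  some finite region, hence in every large enough subcube.
\<close>

section \<open>Counting colourings under local constraints\<close>

text \<open>\<open>b i\<close> bounds the number of bad patterns of constraint \<open>i\<close>, and
  \<beta> is the growth factor aimed at per added point. A new point \<open>v\<close> offers two
  colours, so constraints through it may cost at most \<open>2 - \<beta>\<close>; the exponent in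
  \<open>weight\<close> counts the points of \<open>C i\<close> other than \<open>v\<close>.\<close>

locale local_constraints =
  fixes I :: "'i set" and C :: "'i \<Rightarrow> 'v set" and bad :: "'i \<Rightarrow> ('v \<Rightarrow> bool) \<Rightarrow> bool"
    and b :: "'i \<Rightarrow> real" and \<beta> :: real
  assumes finite_C: "i \<in> I \<Longrightarrow> finite (C i)"
    and C_nonempty: "i \<in> I \<Longrightarrow> C i \<noteq> {}"
    and bad_cong: "i \<in> I \<Longrightarrow> (\<And>v. v \<in> C i \<Longrightarrow> f v = g v) \<Longrightarrow> bad i f \<longleftrightarrow> bad i g"
    and card_bad: "i \<in> I \<Longrightarrow> real (card {f \<in> C i \<rightarrow>\<^sub>E UNIV. bad i f}) \<le> b i"
    and finite_inside: "finite S \<Longrightarrow> finite {i \<in> I. C i \<subseteq> S}"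
    and beta_pos: "0 < \<beta>"
    and weight: "finite S \<Longrightarrow> v \<in> S \<Longrightarrow>
      (\<Sum>i | i \<in> I \<and> v \<in> C i \<and> C i \<subseteq> S. b i / \<beta> ^ (card (C i) - 1)) \<le> 2 - \<beta>"
begin

definition sol :: "'v set \<Rightarrow> ('v \<Rightarrow> bool) set" where
  "sol S = {f \<in> S \<rightarrow>\<^sub>E UNIV. \<forall>i\<in>I. C i \<subseteq> S \<longrightarrow> \<not> bad i f}"

lemma finite_sol: "finite S \<Longrightarrow> finite (sol S)"
  unfolding sol_def by (rule finite_subset[of _ "S \<rightarrow>\<^sub>E UNIV"]) (auto intro: finite_PiE)

lemma restrict_sol: "restrict f T \<in> sol T"
  if "\<And>i. i \<in> I \<Longrightarrow> C i \<subseteq> T \<Longrightarrow> \<not> bad i f"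
proof -
  have "bad i (restrict f T) \<longleftrightarrow> bad i f" if "i \<in> I" "C i \<subseteq> T" for i
    using that by (intro bad_cong) auto
  then show ?thesis using that unfolding sol_def by auto
qed

lemma card_extensions:
  assumes "finite S" "v \<notin> S"
  shows "card {f \<in> insert v S \<rightarrow>\<^sub>E UNIV. restrict f S \<in> sol S} = 2 * card (sol S)"
proof -
  have "bij_betw (\<lambda>(c, f). f(v := c)) (UNIV \<times> sol S)
      {f \<in> insert v S \<rightarrow>\<^sub>E UNIV. restrict f S \<in> sol S}"
  proof (rule bij_betwI[where g = "\<lambda>f. (f v, restrict f S)"])
    have ext: "restrict (f(v := c)) S = f" if "f \<in> sol S" for f and c :: bool
      using that assms(2) unfolding sol_def by (auto simp: fun_eq_iff PiE_def extensional_def)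
    show "(\<lambda>(c, f). f(v := c)) \<in> UNIV \<times> sol S \<rightarrow>
        {f \<in> insert v S \<rightarrow>\<^sub>E UNIV. restrict f S \<in> sol S}"
      using ext by (auto simp: sol_def PiE_def extensional_def)
    show "(\<lambda>f. (f v, restrict f S)) \<in>
        {f \<in> insert v S \<rightarrow>\<^sub>E UNIV. restrict f S \<in> sol S} \<rightarrow> UNIV \<times> sol S"
      by auto
    show "(\<lambda>f. (f v, restrict f S)) (case x of (c, f) \<Rightarrow> f(v := c)) = x"
      if "x \<in> UNIV \<times> sol S" for x
      using that ext by auto
    show "(case (f v, restrict f S) of (c, f) \<Rightarrow> f(v := c)) = f"
      if "f \<in> {f \<in> insert v S \<rightarrow>\<^sub>E UNIV. restrict f S \<in> sol S}" for f
      using that by (auto simp: fun_eq_iff PiE_def extensional_def)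
  qed
  then have "card (UNIV \<times> sol S :: (bool \<times> ('v \<Rightarrow> bool)) set) =
      card {f \<in> insert v S \<rightarrow>\<^sub>E UNIV. restrict f S \<in> sol S}"
    by (rule bij_betw_same_card)
  then show ?thesis by (simp add: card_cartesian_product)
qed

text \<open>Such an extension is recovered from its restrictions to \<open>C i\<close> and
  \<open>S - C i\<close>, which cover \<open>insert v S\<close> because \<open>v \<in> C i\<close>.
  The first is a bad pattern, the second is still a solution.\<close>

lemma card_extensions_bad:
  assumes "finite S" "i \<in> I" "v \<in> C i"
  shows "real (card {f \<in> insert v S \<rightarrow>\<^sub>E UNIV. restrict f S \<in> sol S \<and> bad i f})
    \<le> b i * card (sol (S - C i))"
proof -
  let ?X = "{f \<in> insert v S \<rightarrow>\<^sub>E UNIV. restrict f S \<in> sol S \<and> bad i f}"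
  let ?B = "{f \<in> C i \<rightarrow>\<^sub>E UNIV. bad i f}"
  let ?r = "\<lambda>f. (restrict f (C i), restrict f (S - C i))"
  have fin: "finite (?B \<times> sol (S - C i))"
    using assms(1,2) by (intro finite_cartesian_product finite_sol)
      (auto intro: finite_subset[OF _ finite_PiE[OF finite_C]])
  have r_in: "?r f \<in> ?B \<times> sol (S - C i)" if f: "f \<in> ?X" for f
  proof -
    have "bad i (restrict f (C i)) \<longleftrightarrow> bad i f"
      using assms(2) by (intro bad_cong) auto
    moreover have "\<not> bad j f" if j: "j \<in> I" "C j \<subseteq> S - C i" for j
    proof -
      have "\<not> bad j (restrict f S)"
        using f j unfolding sol_def by auto
      moreover have "bad j (restrict f S) \<longleftrightarrow> bad j f"
        using j by (intro bad_cong) auto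
      ultimately show ?thesis by simp
    qed
    ultimately show ?thesis using f by (auto intro: restrict_sol)
  qed
  have inj: "inj_on ?r ?X"
  proof (rule inj_onI)
    fix f g assume f: "f \<in> ?X" and g: "g \<in> ?X" and eq: "?r f = ?r g"
    have "f x = g x" if "x \<in> insert v S" for x
    proof (cases "x \<in> C i")
      case True
      then show ?thesis using eq by (metis prod.inject restrict_apply')
    next
      case False
      with that assms(3) have "x \<in> S - C i" by auto
      then show ?thesis using eq by (metis prod.inject restrict_apply')
    qed
    then show "f = g" using f g by (intro PiE_ext[of f "insert v S" "\<lambda>_. UNIV" g]) auto
  qed
  have "?r ` ?X \<subseteq> ?B \<times> sol (S - C i)" by (rule image_subsetI) (rule r_in)
  then have "card ?X \<le> card (?B \<times> sol (S - C i))"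
    by (rule card_inj_on_le[OF inj _ fin])
  also have "\<dots> = card ?B * card (sol (S - C i))" by (rule card_cartesian_product)
  finally have "real (card ?X) \<le> real (card ?B) * card (sol (S - C i))"
    unfolding of_nat_mult[symmetric] of_nat_le_iff .
  also have "\<dots> \<le> b i * card (sol (S - C i))"
    using card_bad[OF assms(2)] by (intro mult_right_mono) auto
  finally show ?thesis .
qed


text \<open>Of the \<open>2 * card (sol S)\<close> extensions, all but those spoilt by a constraint
  through \<open>v\<close> are solutions. The induction hypothesis bounds
  \<open>sol (S - C i)\<close> in terms of \<open>sol S\<close>, and \<open>weight\<close> then
  limits the loss to \<open>(2 - \<beta>) * card (sol S)\<close>.\<close>

lemma card_sol_insert:
  assumes "finite S" "v \<notin> S"
  shows "\<beta> * card (sol S) \<le> card (sol (insert v S))"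
  using assms
proof (induction "card S" arbitrary: S v rule: less_induct)
  case less
  \<comment> \<open>The points of \<open>D\<close> are put back one at a time; each region before
    such a step is smaller than \<open>S\<close>, so the induction hypothesis applies to it.\<close>
  have grow: "\<beta> ^ card D * card (sol (S - D)) \<le> card (sol S)" if "D \<subseteq> S" for D
  proof -
    have "finite D" using that less.prems(1) by (rule finite_subset)
    then show ?thesis using that
    proof (induction D)
      case empty
      show ?case by simp
    next
      case (insert x D)
      have eq: "insert x (S - insert x D) = S - D" using insert by auto
      have "card (S - insert x D) < card S"
        using insert.prems less.prems(1) by (intro psubset_card_mono) auto
      from less.hyps[OF this, of x]
      have "\<beta> * card (sol (S - insert x D)) \<le> card (sol (S - D))"
        using less.prems(1) eq by simp
      then have "\<beta> ^ card D * (\<beta> * card (sol (S - insert x D))) \<le> \<beta> ^ card D * card (sol (S - D))"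
        using beta_pos by (intro mult_left_mono) auto
      also have "\<dots> \<le> card (sol S)" using insert by auto
      finally show ?case using insert.hyps by (simp add: mult_ac)
    qed
  qed
  define J where "J = {i. i \<in> I \<and> v \<in> C i \<and> C i \<subseteq> insert v S}"
  define X where "X = {f \<in> insert v S \<rightarrow>\<^sub>E UNIV. restrict f S \<in> sol S}"
  define Y where "Y = (\<lambda>i. {f \<in> insert v S \<rightarrow>\<^sub>E UNIV. restrict f S \<in> sol S \<and> bad i f})"
  have finJ: "finite J"
    unfolding J_def using less.prems(1)
    by (intro finite_subset[OF _ finite_inside[of "insert v S"]]) auto
  have finX: "finite X"
    unfolding X_def using less.prems(1)
    by (intro finite_subset[OF _ finite_PiE[of "insert v S" "\<lambda>_. UNIV"]]) auto
  \<comment> \<open>A constraint inside \<open>insert v S\<close> that misses \<open>v\<close> lies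
    inside \<open>S\<close> and already holds, so only those in \<open>J\<close> can fail.\<close>
  have "X \<subseteq> sol (insert v S) \<union> (\<Union>i\<in>J. Y i)"
  proof
    fix f assume f: "f \<in> X"
    have "f \<in> sol (insert v S)" if no: "\<not> (\<exists>i\<in>J. bad i f)"
    proof -
      have "\<not> bad i f" if i: "i \<in> I" "C i \<subseteq> insert v S" for i
      proof (cases "v \<in> C i")
        case True
        then show ?thesis using i no unfolding J_def by blast
      next
        case False
        with i have sub: "C i \<subseteq> S" by auto
        then have "bad i (restrict f S) \<longleftrightarrow> bad i f"
          using i by (intro bad_cong) auto
        with f sub i show ?thesis unfolding X_def sol_def by auto
      qed
      then show ?thesis using f unfolding X_def sol_def by auto
    qed
    then show "f \<in> sol (insert v S) \<union> (\<Union>i\<in>J. Y i)"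
      using f unfolding X_def Y_def by blast
  qed
  then have "card X \<le> card (sol (insert v S) \<union> (\<Union>i\<in>J. Y i))"
  proof (rule card_mono[rotated])
    show "finite (sol (insert v S) \<union> (\<Union>i\<in>J. Y i))"
      using finJ finX less.prems(1) unfolding X_def Y_def
      by (auto intro: finite_sol rev_finite_subset)
  qed
  also have "\<dots> \<le> card (sol (insert v S)) + card (\<Union>i\<in>J. Y i)" by (rule card_Un_le)
  also have "\<dots> \<le> card (sol (insert v S)) + (\<Sum>i\<in>J. card (Y i))"
    using card_UN_le[OF finJ] by simp
  finally have "real (card X) \<le> card (sol (insert v S)) + (\<Sum>i\<in>J. real (card (Y i)))"
    unfolding of_nat_sum[symmetric] of_nat_add[symmetric] of_nat_le_iff .
  moreover have "real (card X) = 2 * card (sol S)"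
    unfolding X_def using card_extensions[OF less.prems] by simp
  moreover have "(\<Sum>i\<in>J. real (card (Y i))) \<le> (2 - \<beta>) * card (sol S)"
  proof -
    have "real (card (Y i)) \<le> b i / \<beta> ^ (card (C i) - 1) * card (sol S)" if i: "i \<in> J" for i
    proof -
      have iI: "i \<in> I" "v \<in> C i" "C i \<subseteq> insert v S" using i unfolding J_def by auto
      have b0: "0 \<le> b i" using card_bad[OF iI(1)] by linarith
      \<comment> \<open>As \<open>v \<notin> S\<close>, only \<open>card (C i) - 1\<close> points of
        \<open>C i\<close> are removed from \<open>S\<close>; hence the exponent in
        \<open>weight\<close>.\<close>
      have D: "C i \<inter> S = C i - {v}" using iI less.prems by auto
      have "card (C i \<inter> S) = card (C i) - 1"
        unfolding D using iI by (simp add: card_Diff_singleton)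
      moreover have "S - C i \<inter> S = S - C i" by auto
      ultimately have "\<beta> ^ (card (C i) - 1) * card (sol (S - C i)) \<le> card (sol S)"
        using grow[of "C i \<inter> S"] by simp
      then have "card (sol (S - C i)) \<le> card (sol S) / \<beta> ^ (card (C i) - 1)"
        using beta_pos by (simp add: field_simps)
      then have "b i * card (sol (S - C i)) \<le> b i * (card (sol S) / \<beta> ^ (card (C i) - 1))"
        using b0 by (rule mult_left_mono)
      with card_extensions_bad[OF less.prems(1) iI(1,2)] show ?thesis
        unfolding Y_def by simp
    qed
    then have "(\<Sum>i\<in>J. real (card (Y i))) \<le> (\<Sum>i\<in>J. b i / \<beta> ^ (card (C i) - 1) * card (sol S))"
      by (rule sum_mono)
    also have "\<dots> = (\<Sum>i\<in>J. b i / \<beta> ^ (card (C i) - 1)) * card (sol S)"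
      by (rule sum_distrib_right[symmetric])
    also have "\<dots> \<le> (2 - \<beta>) * card (sol S)"
      unfolding J_def using less.prems(1) by (intro mult_right_mono weight) auto
    finally show ?thesis .
  qed
  ultimately show ?case unfolding left_diff_distrib by linarith
qed

lemma ex_sol:
  assumes "finite S"
  shows "\<exists>f. \<forall>i\<in>I. C i \<subseteq> S \<longrightarrow> \<not> bad i f"
proof -
  have "card (sol S) > 0" using assms
  proof (induction S)
    case empty
    \<comment> \<open>By \<open>C_nonempty\<close> no constraint lies inside the empty region, so
      its single colouring is a solution.\<close>
    have "(\<lambda>_. undefined) \<in> sol {}" using C_nonempty unfolding sol_def by auto
    then show ?case using finite_sol[of "{}"] by (auto simp: card_gt_0_iff)
  next
    case (insert v S)
    then have "0 < \<beta> * card (sol S)" using beta_pos by simp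
    also have "\<dots> \<le> card (sol (insert v S))" using insert by (intro card_sol_insert)
    finally show ?case by simp
  qed
  then obtain f where "f \<in> sol S" by (metis card_gt_0_iff ex_in_conv)
  then have "\<forall>i\<in>I. C i \<subseteq> S \<longrightarrow> \<not> bad i f" unfolding sol_def by simp
  then show ?thesis by (intro exI[of _ f])
qed

end

section \<open>Avoidable patterns and almost periodicity\<close>

lemma grid_eq_lists: "grid d k = {i. set i \<subseteq> {..<k} \<and> length i = d}"
  unfolding grid_def by auto

lemma finite_grid: "finite (grid d k)"
  unfolding grid_eq_lists by (rule finite_lists_length_eq) simp

lemma card_grid: "card (grid d k) = k ^ d"
  unfolding grid_eq_lists by (simp add: card_lists_length_eq)

definition cube :: "nat \<Rightarrow> int list \<Rightarrow> nat \<Rightarrow> int list set" where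
  "cube d m k = map2 (\<lambda>a b. a + int b) m ` grid d k"

lemma finite_cube: "finite (cube d m k)"
  unfolding cube_def using finite_grid by (rule finite_imageI)

lemma in_cube_iff:
  assumes "length m = d"
  shows "p \<in> cube d m k \<longleftrightarrow> length p = d \<and> (\<forall>j<d. m ! j \<le> p ! j \<and> p ! j < m ! j + int k)"
proof
  assume "p \<in> cube d m k"
  then obtain i where i: "i \<in> grid d k" "p = map2 (\<lambda>a b. a + int b) m i"
    unfolding cube_def by auto
  then show "length p = d \<and> (\<forall>j<d. m ! j \<le> p ! j \<and> p ! j < m ! j + int k)"
    using assms by (auto simp: grid_def)
next
  assume p: "length p = d \<and> (\<forall>j<d. m ! j \<le> p ! j \<and> p ! j < m ! j + int k)"
  define i where "i = map2 (\<lambda>a b. nat (a - b)) p m"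
  have "i ! j < k" if "j < d" for j
  proof -
    have "m ! j \<le> p ! j" "p ! j < m ! j + int k" using p that by auto
    then have "nat (p ! j - m ! j) < k" by linarith
    then show ?thesis using p assms that by (simp add: i_def)
  qed
  then have "i \<in> grid d k"
    using p assms by (auto simp: i_def grid_def in_set_conv_nth)
  moreover have "p = map2 (\<lambda>a b. a + int b) m i"
    using p assms by (auto simp: i_def list_eq_iff_nth_eq)
  ultimately show "p \<in> cube d m k" unfolding cube_def by blast
qed

lemma inj_on_cube:
  assumes "length m = d"
  shows "inj_on (map2 (\<lambda>a b. a + int b) m) (grid d k)"
proof (rule inj_onI)
  fix i j assume ij: "i \<in> grid d k" "j \<in> grid d k"
    and eq: "map2 (\<lambda>a b. a + int b) m i = map2 (\<lambda>a b. a + int b) m j"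
  have "i ! l = j ! l" if "l < d" for l
    using arg_cong[OF eq, of "\<lambda>p. p ! l"] that ij assms by (simp add: grid_def)
  then show "i = j" using ij by (auto simp: grid_def list_eq_iff_nth_eq)
qed

lemma card_cube: "length m = d \<Longrightarrow> card (cube d m k) = k ^ d"
  unfolding cube_def by (simp add: card_image inj_on_cube card_grid)

lemma subcube_eq_iff:
  "subcube d n f m = subcube d n g m \<longleftrightarrow> (\<forall>p \<in> cube d m n. f p = g p)"
  unfolding subcube_def cube_def by (auto simp: fun_eq_iff restrict_def)

section \<open>Compactness and Zorn's lemma for avoidable patterns\<close>

lemma bool_sequence_compact:
  fixes f :: "nat \<Rightarrow> 'a::countable \<Rightarrow> bool"
  shows "\<exists>\<omega>. \<forall>A N. finite A \<longrightarrow> (\<exists>n\<ge>N. \<forall>p\<in>A. f n p = \<omega> p)"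
proof -
  \<comment> \<open>Diagonal argument: in a decreasing chain of infinite index sets, passing to
    \<open>S (Suc i)\<close> fixes the colour of the point \<open>from_nat i\<close>.\<close>
  have "\<exists>S. \<forall>i. infinite (S i :: nat set) \<and> (S (Suc i) \<subseteq> S i \<and>
      (\<exists>c. \<forall>n\<in>S (Suc i). f n (from_nat i) = c))"
  proof (rule dependent_nat_choice)
    show "\<exists>S :: nat set. infinite S" by (rule exI[of _ UNIV]) simp
    fix S :: "nat set" and i assume S: "infinite S"
    let ?T = "\<lambda>c. {n \<in> S. f n (from_nat i) = c}"
    have "S = ?T True \<union> ?T False" by auto
    then have "finite S" if "finite (?T True)" "finite (?T False)"
      using finite_UnI[OF that] by simp
    with S have "infinite (?T True) \<or> infinite (?T False)" by blast
    then obtain c where "infinite (?T c)" by blast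
    then show "\<exists>T. infinite T \<and> (T \<subseteq> S \<and> (\<exists>c. \<forall>n\<in>T. f n (from_nat i) = c))"
      by (intro exI[of _ "?T c"]) auto
  qed
  then obtain S where inf: "\<And>i. infinite (S i :: nat set)" and dec: "\<And>i. S (Suc i) \<subseteq> S i"
    and const: "\<And>i. \<exists>c. \<forall>n\<in>S (Suc i). f n (from_nat i) = c" by blast
  from const obtain c where c: "\<And>i n. n \<in> S (Suc i) \<Longrightarrow> f n (from_nat i) = c i" by metis
  have anti: "S j \<subseteq> S i" if "i \<le> j" for i j
    using dec that by (rule lift_Suc_antimono_le)
  show ?thesis
  proof (rule exI[of _ "\<lambda>p. c (to_nat p)"], intro allI impI)
    fix A :: "'a set" and N :: nat assume A: "finite A"
    \<comment> \<open>The index set following the largest code in \<open>A\<close> is contained in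
      all earlier ones, so it settles every colour on \<open>A\<close>; being infinite, it has
      members beyond \<open>N\<close>.\<close>
    obtain n where n: "n \<ge> N" "n \<in> S (Suc (Max (to_nat ` A)))"
      using inf by (meson infinite_nat_iff_unbounded_le)
    have "f n p = c (to_nat p)" if "p \<in> A" for p
    proof -
      have "to_nat p \<le> Max (to_nat ` A)" using A that by auto
      with n anti[of "Suc (to_nat p)" "Suc (Max (to_nat ` A))"]
      have "n \<in> S (Suc (to_nat p))" by auto
      from c[OF this] show ?thesis by simp
    qed
    with n show "\<exists>n\<ge>N. \<forall>p\<in>A. f n p = c (to_nat p)" by blast
  qed
qed

text \<open>The side is stored with each pattern because a \<open>bool\<close>-valued extensional
  function need not reveal its domain. Only cubes wholly inside \<open>S\<close> are tested, so the
  condition depends on the values on \<open>S\<close> alone.\<close>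

definition avoids :: "nat \<Rightarrow> (nat \<times> (nat list \<Rightarrow> bool)) set \<Rightarrow> int list set \<Rightarrow>
    (int list \<Rightarrow> bool) \<Rightarrow> bool" where
  "avoids d P S \<omega> \<longleftrightarrow>
    (\<forall>m \<in> lattice_points d. \<forall>n. cube d m n \<subseteq> S \<longrightarrow> (n, subcube d n \<omega> m) \<notin> P)"

text \<open>The colouring may differ from region to region; in this form the property passes to
  unions of chains.\<close>

definition avoidable :: "nat \<Rightarrow> (nat \<times> (nat list \<Rightarrow> bool)) set \<Rightarrow> bool" where
  "avoidable d P \<longleftrightarrow> (\<forall>S. finite S \<longrightarrow> (\<exists>\<omega>. avoids d P S \<omega>))"

text \<open>A limit of colourings that avoid \<open>P\<close> on growing finite regions: a pattern
  occurring in the limit also occurs in arbitrarily late members.\<close>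

lemma avoidable_imp_avoids_UNIV:
  assumes "avoidable d P"
  shows "\<exists>\<omega>. avoids d P UNIV \<omega>"
proof -
  define S where "S n = {p :: int list. to_nat p < n}" for n
  have "finite (S n)" for n
    unfolding S_def by (rule finite_imageD[of to_nat])
      (auto intro: finite_subset[of _ "{..<n}"] inj_on_subset[OF inj_to_nat])
  then have "\<forall>n. \<exists>f. avoids d P (S n) f"
    using assms unfolding avoidable_def by blast
  from choice[OF this] obtain f where f: "\<And>n. avoids d P (S n) (f n)" by blast
  obtain \<omega> where \<omega>: "\<And>A N. finite A \<Longrightarrow> \<exists>n\<ge>N. \<forall>p\<in>A. f n p = \<omega> p"
    using bool_sequence_compact[of f] by blast
  have "(n, subcube d n \<omega> m) \<notin> P" if m: "m \<in> lattice_points d" for m n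
  proof -
    let ?C = "cube d m n"
    \<comment> \<open>\<open>l\<close> exceeds the codes of all points of the cube, so the cube lies
      in the region where \<open>f l\<close> avoids \<open>P\<close>.\<close>
    obtain l where l: "l \<ge> Suc (Max (to_nat ` ?C))" "\<forall>p\<in>?C. f l p = \<omega> p"
      using \<omega>[OF finite_cube] by blast
    have "?C \<subseteq> S l"
    proof
      fix p assume "p \<in> ?C"
      then have "to_nat p \<le> Max (to_nat ` ?C)" using finite_cube by auto
      with l(1) show "p \<in> S l" unfolding S_def by simp
    qed
    then have "(n, subcube d n (f l) m) \<notin> P"
      using f[of l] m unfolding avoids_def by blast
    moreover have "subcube d n (f l) m = subcube d n \<omega> m"
      using l(2) by (simp add: subcube_eq_iff)
    ultimately show ?thesis by simp
  qed
  then show ?thesis unfolding avoids_def by blast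
qed

lemma avoids_restrict: "avoids d P S (restrict \<omega> S) \<longleftrightarrow> avoids d P S \<omega>"
proof -
  have "subcube d n (restrict \<omega> S) m = subcube d n \<omega> m" if "cube d m n \<subseteq> S" for m n
    using that by (auto simp: subcube_eq_iff)
  then show ?thesis unfolding avoids_def by simp
qed

text \<open>A finite region has finitely many colourings, so if each of them contained
  a pattern of the union, one member of the chain would already be unavoidable.\<close>

lemma avoidable_Union_chain:
  assumes "\<C> \<noteq> {}" "subset.chain \<A> \<C>" and av: "\<And>P. P \<in> \<C> \<Longrightarrow> avoidable d P"
  shows "avoidable d (\<Union>\<C>)"
  unfolding avoidable_def
proof (intro allI impI, rule ccontr)
  fix S :: "int list set"
  assume S: "finite S" and no: "\<not> (\<exists>\<omega>. avoids d (\<Union>\<C>) S \<omega>)"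
  define X where "X = S \<rightarrow>\<^sub>E (UNIV :: bool set)"
  have "finite X" unfolding X_def using S by (intro finite_PiE) auto
  have "\<exists>q. q \<in> \<Union>\<C> \<and> (\<exists>m \<in> lattice_points d. \<exists>n. cube d m n \<subseteq> S \<and> q = (n, subcube d n \<omega> m))" for \<omega>
    using no unfolding avoids_def by blast
  then have "\<forall>\<omega>. \<exists>q. q \<in> \<Union>\<C> \<and>
      (\<exists>m \<in> lattice_points d. \<exists>n. cube d m n \<subseteq> S \<and> q = (n, subcube d n \<omega> m))"
    by blast
  from choice[OF this] obtain q where q: "\<And>\<omega>. q \<omega> \<in> \<Union>\<C>"
    "\<And>\<omega>. \<exists>m \<in> lattice_points d. \<exists>n. cube d m n \<subseteq> S \<and> q \<omega> = (n, subcube d n \<omega> m)"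
    by blast
  obtain B where B: "B \<in> \<C>" "q ` X \<subseteq> B"
    using finite_subset_Union_chain[OF finite_imageI[OF \<open>finite X\<close>] _ assms(1,2), of q] q(1) by blast
  from av[OF B(1)] S obtain \<omega> where "avoids d B S \<omega>" unfolding avoidable_def by blast
  then have "avoids d B S (restrict \<omega> S)" by (simp add: avoids_restrict)
  moreover have "q (restrict \<omega> S) \<in> B" using B(2) unfolding X_def by auto
  ultimately show False using q(2)[of "restrict \<omega> S"] unfolding avoids_def by metis
qed

text \<open>Zorn's lemma for the avoidable supersets of \<open>F\<close>. Maximality is kept in the
  form of single added patterns, which is how an occurring pattern is tested later.\<close>

lemma maximal_avoidable:
  assumes "avoidable d F"
  shows "\<exists>P. F \<subseteq> P \<and> avoidable d P \<and> (\<forall>q. q \<notin> P \<longrightarrow> \<not> avoidable d (insert q P))"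
proof -
  let ?A = "{P. F \<subseteq> P \<and> avoidable d P}"
  have "\<exists>M\<in>?A. \<forall>X\<in>?A. M \<subseteq> X \<longrightarrow> X = M"
  proof (rule subset_Zorn_nonempty)
    show "?A \<noteq> {}" using assms by auto
    fix \<C> assume C: "\<C> \<noteq> {}" "subset.chain ?A \<C>"
    then have "\<C> \<subseteq> ?A" by (simp add: subset_chain_def)
    with C show "\<Union>\<C> \<in> ?A" using avoidable_Union_chain[OF C, of d] by blast
  qed
  then obtain M where M: "M \<in> ?A" and max: "\<forall>X\<in>?A. M \<subseteq> X \<longrightarrow> X = M" by (rule bexE)
  have "\<not> avoidable d (insert q M)" if "q \<notin> M" for q
  proof
    assume "avoidable d (insert q M)"
    with M have "insert q M \<in> ?A" by auto
    with max have "insert q M = M" by blast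
    with that show False by blast
  qed
  with M show ?thesis by (intro exI[of _ M]) simp
qed

section \<open>From maximality to almost periodicity\<close>

lemma finite_subset_cube:
  assumes "finite S"
  shows "\<exists>c k. length c = d \<and> S \<inter> lattice_points d \<subseteq> cube d c k"
proof -
  \<comment> \<open>\<open>M\<close> bounds all coordinates in absolute value; the interval from
    \<open>- M\<close> to \<open>M\<close> has \<open>2 * M + 1\<close> integers.\<close>
  define M where "M = Max ((\<lambda>a. nat \<bar>a\<bar>) ` (\<Union>p\<in>S. set p))"
  have M: "\<bar>p ! j\<bar> \<le> int M" if "p \<in> S" "j < length p" for p j
  proof -
    have "nat \<bar>p ! j\<bar> \<le> M"
      unfolding M_def using assms that by (intro Max_ge) (auto intro!: imageI bexI[of _ p])
    then show ?thesis by linarith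
  qed
  have "p \<in> cube d (replicate d (- int M)) (2 * M + 1)" if "p \<in> S" "length p = d" for p
    using M[of p] that by (auto simp: in_cube_iff abs_le_iff) (smt (verit))+
  then show ?thesis
    by (intro exI[of _ "replicate d (- int M)"] exI[of _ "2 * M + 1"]) (auto simp: lattice_points_def)
qed

text \<open>A pattern \<open>x\<close> occurring in \<omega> lies outside \<open>P\<close>, so
  adding it makes some finite region \<open>S\<close> impossible to colour. Every translate of
  \<omega> then shows \<open>x\<close> inside \<open>S\<close>, hence inside a fixed cube around the
  lattice points of \<open>S\<close>.\<close>

lemma maximal_imp_almost_periodic:
  assumes avoid: "avoids d P UNIV \<omega>"
    and max: "\<And>q. q \<notin> P \<Longrightarrow> \<not> avoidable d (insert q P)"
  shows "almost_periodic d \<omega>"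
  unfolding almost_periodic_def
proof (intro allI impI)
  fix n x assume "\<exists>m\<in>lattice_points d. x = subcube d n \<omega> m"
  then have "(n, x) \<notin> P" using avoid unfolding avoids_def by auto
  then have "\<not> avoidable d (insert (n, x) P)" by (rule max)
  then obtain S where S: "finite S" "\<And>\<omega>'. \<not> avoids d (insert (n, x) P) S \<omega>'"
    unfolding avoidable_def by blast
  from finite_subset_cube[OF S(1)] obtain c k where
    c: "length c = d" "S \<inter> lattice_points d \<subseteq> cube d c k" by blast
  show "\<exists>k. \<forall>m\<in>lattice_points d. occurs_in d n x k (subcube d k \<omega> m)"
  proof (intro exI ballI)
    fix m assume "m \<in> lattice_points d"
    then have m: "length m = d" by (simp add: lattice_points_def)
    \<comment> \<open>The translation takes \<open>c\<close> to \<open>m\<close>, so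
      \<open>\<omega> \<circ> shift\<close> shows on the cube at \<open>c\<close> what \<omega>
      shows on the window at \<open>m\<close>.\<close>
    define shift where "shift p = map2 (+) p (map2 (-) m c)" for p
    have len_shift: "length (shift p) = d" if "length p = d" for p
      using that m c(1) by (simp add: shift_def)
    have nth_shift: "shift p ! j = p ! j + (m ! j - c ! j)" if "length p = d" "j < d" for p j
      using that m c(1) by (simp add: shift_def)
    have sub: "subcube d n' (\<omega> \<circ> shift) u = subcube d n' \<omega> (shift u)" if u: "length u = d" for n' u
    proof -
      have "shift (map2 (\<lambda>a b. a + int b) u i) = map2 (\<lambda>a b. a + int b) (shift u) i"
        if "i \<in> grid d n'" for i
        using that u m c(1) by (auto simp: grid_def list_eq_iff_nth_eq len_shift nth_shift)
      then show ?thesis unfolding subcube_def by (auto simp: fun_eq_iff restrict_def)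
    qed
    from S(2)[of "\<omega> \<circ> shift"] obtain u n' where u: "length u = d" "cube d u n' \<subseteq> S"
      "(n', subcube d n' (\<omega> \<circ> shift) u) \<in> insert (n, x) P"
      unfolding avoids_def lattice_points_def by blast
    \<comment> \<open>\<omega> avoids \<open>P\<close> at every position, so the pattern found in
      the translate can only be \<open>(n, x)\<close>.\<close>
    have "(n', subcube d n' \<omega> (shift u)) \<notin> P"
      using avoid u(1) len_shift unfolding avoids_def lattice_points_def by auto
    with u sub have [simp]: "n' = n" and x: "x = subcube d n \<omega> (shift u)" by auto
    \<comment> \<open>An empty cube yields no bounds on \<open>u\<close>, so the offset is set to 0 for \<open>n = 0\<close>.\<close>
    define s where "s = map2 (\<lambda>a b. if n = 0 then 0 else nat (a - b)) u c"
    \<comment> \<open>Two opposite corners of the cube at \<open>u\<close> lie in the enclosing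
      cube, which bounds each coordinate from both sides.\<close>
    have bnd: "c ! j \<le> u ! j \<and> u ! j + int n \<le> c ! j + int k" if "n > 0" "j < d" for j
    proof -
      have "u \<in> cube d u n" "map (\<lambda>a. a + int (n - 1)) u \<in> cube d u n"
        using u(1) that by (auto simp: in_cube_iff)
      then have "u \<in> cube d c k" "map (\<lambda>a. a + int (n - 1)) u \<in> cube d c k"
        using u c by (auto simp: lattice_points_def)
      then show ?thesis using that u(1) c(1) by (auto simp: in_cube_iff)
    qed
    have len_s: "length s = d" using u c by (simp add: s_def)
    have nth_s: "int (s ! j) = u ! j - c ! j" if "n > 0" "j < d" for j
      using bnd[OF that] that u(1) c(1) by (simp add: s_def)
    have s_le: "s ! j + n \<le> k" if "j < d" for j
    proof (cases "n = 0")
      case True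
      then show ?thesis using that u(1) c(1) by (simp add: s_def)
    next
      case False
      then show ?thesis using bnd[of j] nth_s[of j] that by linarith
    qed
    have "x i = subcube d k \<omega> m (map2 (+) s i)" if i: "i \<in> grid d n" for i
    proof -
      have i': "length i = d" "\<And>j. j < d \<Longrightarrow> i ! j < n" using i by (auto simp: grid_def)
      have "map2 (+) s i \<in> grid d k"
        unfolding grid_def using i' len_s s_le by (fastforce simp: in_set_conv_nth)
      \<comment> \<open>Both sides are the point \<open>m + (u - c) + i\<close>; a coordinate
        \<open>j\<close> forces \<open>n > 0\<close>, so \<open>s\<close> is the true
        difference.\<close>
      moreover have "map2 (\<lambda>a b. a + int b) (shift u) i = map2 (\<lambda>a b. a + int b) m (map2 (+) s i)"
      proof (rule nth_equalityI)
        fix j assume "j < length (map2 (\<lambda>a b. a + int b) (shift u) i)"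
        then have j: "j < d" using i' u(1) len_shift by simp
        with i'(2)[OF j] nth_s[of j] i'(1) u(1) len_shift len_s m
        show "map2 (\<lambda>a b. a + int b) (shift u) i ! j = map2 (\<lambda>a b. a + int b) m (map2 (+) s i) ! j"
          by (simp add: nth_shift)
      qed (use i' u(1) len_shift len_s m in simp)
      ultimately show ?thesis using i x by (simp add: subcube_def)
    qed
    moreover have "\<forall>a\<in>set s. a + n \<le> k" using s_le len_s by (auto simp: in_set_conv_nth)
    ultimately show "occurs_in d n x k (subcube d k \<omega> m)"
      unfolding occurs_in_def using len_s by blast
  qed
qed

section \<open>Patterns of low complexity\<close>

lemma summable_of_nat_times_power:
  fixes c :: real
  assumes "0 \<le> c" "c < 1"
  shows "summable (\<lambda>n. real n * c ^ n)"
proof (cases "c = 0")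
  case True
  have "(\<lambda>n. real n * c ^ n) = (\<lambda>_. 0)"
    using True by (auto simp: fun_eq_iff power_0_left)
  then show ?thesis by simp
next
  case False
  have "(\<lambda>n. real n * (sqrt c) ^ n) \<longlonglongrightarrow> 0"
    using assms by (intro powser_times_n_limit_0) auto
  then have "Bseq (\<lambda>n. real n * (sqrt c) ^ n)" by (intro convergent_imp_Bseq convergentI)
  then obtain K where K: "\<And>n. norm (real n * (sqrt c) ^ n) \<le> K" by (metis BseqD)
  show ?thesis
  proof (rule summable_comparison_test')
    show "summable (\<lambda>n. K * (sqrt c) ^ n)"
      using assms by (intro summable_mult summable_geometric) auto
    fix n :: nat
    \<comment> \<open>One factor \<open>sqrt c ^ n\<close> absorbs \<open>n\<close>, the other
      leaves a geometric series.\<close>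
    have "real n * c ^ n = (real n * (sqrt c) ^ n) * (sqrt c) ^ n"
      using assms by (simp flip: power_mult_distrib)
    also have "norm \<dots> \<le> K * (sqrt c) ^ n"
      using K[of n] assms by (auto simp: norm_mult intro!: mult_right_mono)
    finally show "norm (real n * c ^ n) \<le> K * (sqrt c) ^ n" .
  qed
qed

text \<open>The powers \<open>k ^ d\<close> are distinct and at least \<open>N\<close>, so the sum
  is part of a tail of a convergent series. The bound is uniform in \<open>M\<close> because the
  regions to be coloured may be arbitrarily large.\<close>

lemma small_tail_of_power_sum:
  fixes c \<epsilon> :: real
  assumes "0 < c" "c < 1" "d \<ge> 1" "0 < \<epsilon>"
  shows "\<exists>N. \<forall>M. (\<Sum>k\<in>{N<..M}. real (k ^ d) * c ^ (k ^ d)) \<le> \<epsilon>"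
proof -
  let ?g = "\<lambda>n. real n * c ^ n"
  have "summable ?g" using assms by (intro summable_of_nat_times_power) auto
  then obtain N where N: "\<And>m n. m \<ge> N \<Longrightarrow> norm (sum ?g {m..<n}) < \<epsilon>"
    using assms(4) unfolding summable_Cauchy by blast
  have "(\<Sum>k\<in>{N<..M}. ?g (k ^ d)) \<le> \<epsilon>" for M
  proof -
    have inj: "inj_on (\<lambda>k. k ^ d) {N<..M}"
      using assms(3) by (auto intro!: inj_onI dest: power_eq_imp_eq_base)
    have "(\<Sum>k\<in>{N<..M}. ?g (k ^ d)) = sum ?g ((\<lambda>k. k ^ d) ` {N<..M})"
      by (simp add: sum.reindex[OF inj])
    also have "\<dots> \<le> sum ?g {N..<Suc (M ^ d)}"
    proof (rule sum_mono2)
      have "N \<le> k ^ d" if "N < k" for k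
        using that assms(3) self_le_power[of k d] by linarith
      then show "(\<lambda>k. k ^ d) ` {N<..M} \<subseteq> {N..<Suc (M ^ d)}"
        by (auto simp: less_Suc_eq_le intro: power_mono)
    qed (use assms in auto)
    also have "\<dots> \<le> norm \<dots>" by simp
    also have "\<dots> \<le> \<epsilon>" by (rule less_imp_le[OF N[OF order_refl]])
    finally show ?thesis .
  qed
  then show ?thesis by blast
qed

section \<open>Counting strings of low complexity\<close>

lemma low_complexity_finite_card:
  assumes "0 \<le> t"
  shows "finite {y. ereal_of_enat (complexity U y) < ereal t} \<and>
    real (card {y. ereal_of_enat (complexity U y) < ereal t}) \<le> 2 * 2 powr t"
proof -
  \<comment> \<open>Program lengths are integers, so a length below \<open>t\<close> is at most
    \<open>L\<close>; each program yields at most one string.\<close>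
  define L where "L = nat \<lfloor>t\<rfloor>"
  let ?P = "{p :: bool list. set p \<subseteq> UNIV \<and> length p \<le> L}"
  have "{y. ereal_of_enat (complexity U y) < ereal t} \<subseteq> (\<lambda>p. the (U p)) ` ?P"
  proof
    fix y assume "y \<in> {y. ereal_of_enat (complexity U y) < ereal t}"
    then have lt: "ereal_of_enat (complexity U y) < ereal t" by simp
    have "\<exists>p. U p = Some y \<and> length p \<le> L"
    proof (rule ccontr)
      assume "\<not> ?thesis"
      then have "enat (Suc L) \<le> complexity U y"
        unfolding complexity_def by (intro INF_greatest) (auto simp: not_le Suc_le_eq)
      then have "ereal_of_enat (enat (Suc L)) \<le> ereal_of_enat (complexity U y)"
        by (simp only: ereal_of_enat_le_iff)
      also note lt
      finally have "real L + 1 < t" by simp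
      then show False unfolding L_def by linarith
    qed
    then show "y \<in> (\<lambda>p. the (U p)) ` ?P" by force
  qed
  moreover have fin: "finite ?P" by (rule finite_lists_length_le) simp
  ultimately have "finite {y. ereal_of_enat (complexity U y) < ereal t}"
    and "card {y. ereal_of_enat (complexity U y) < ereal t} \<le> card ?P"
    by (auto intro: finite_subset finite_imageI surj_card_le)
  moreover have "real (card ?P) \<le> 2 * 2 powr t"
  proof -
    have "card ?P = (\<Sum>i\<le>L. card (UNIV :: bool set) ^ i)" by (rule card_lists_length_le) simp
    also have "\<dots> = (\<Sum>i<Suc L. 2 ^ i)" by (simp add: lessThan_Suc_atMost)
    also have "\<dots> = 2 ^ Suc L - 1"
      using sum_power2[of "Suc L"] by (simp add: lessThan_atLeast0)
    finally have "real (card ?P) \<le> real (2 ^ Suc L)" by simp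
    also have "\<dots> = 2 * 2 powr real L" by (simp add: powr_realpow)
    also have "\<dots> \<le> 2 * 2 powr t" using assms unfolding L_def by simp
    finally show ?thesis .
  qed
  ultimately show ?thesis by linarith
qed

lemma inj_on_cube_string: "inj_on (cube_string d k) (grid d k \<rightarrow>\<^sub>E UNIV)"
proof (rule inj_onI)
  fix x y :: "nat list \<Rightarrow> bool"
  assume xy: "x \<in> grid d k \<rightarrow>\<^sub>E UNIV" "y \<in> grid d k \<rightarrow>\<^sub>E UNIV"
    and eq: "cube_string d k x = cube_string d k y"
  have "x i = y i" if "i \<in> grid d k" for i
    using eq that unfolding cube_string_def by (simp add: set_product_lists_grid)
  then show "x = y" by (rule PiE_ext[OF xy])
qed

section \<open>Total weight of the forbidden cubes through a point\<close>

lemma card_cubes_through: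
  "finite {m \<in> lattice_points d. v \<in> cube d m k} \<and> card {m \<in> lattice_points d. v \<in> cube d m k} \<le> k ^ d"
proof (cases "length v = d")
  case True
  \<comment> \<open>In each coordinate a corner \<open>m\<close> of a cube through \<open>v\<close>
    lies between \<open>v - k + 1\<close> and \<open>v\<close>.\<close>
  let ?u = "map (\<lambda>a. a - int k + 1) v"
  have sub: "{m \<in> lattice_points d. v \<in> cube d m k} \<subseteq> cube d ?u k"
    using True by (auto simp: lattice_points_def in_cube_iff) (smt (verit))+
  have "card (cube d ?u k) = k ^ d" using True by (intro card_cube) simp
  then show ?thesis
    using finite_subset[OF sub finite_cube] card_mono[OF finite_cube sub] by simp
next
  case False
  then have empty: "{m \<in> lattice_points d. v \<in> cube d m k} = {}"
    by (auto simp: lattice_points_def in_cube_iff)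
  show ?thesis unfolding empty by simp
qed

text \<open>The counting argument with one constraint per cube position. A point lies in at most
  \<open>k ^ d\<close> cubes of side \<open>k\<close>, each of weight
  \<open>b k / \<beta> ^ (k ^ d - 1)\<close>.\<close>

lemma few_patterns_avoidable:
  fixes F :: "(nat \<times> (nat list \<Rightarrow> bool)) set" and b :: "nat \<Rightarrow> real" and \<beta> :: real
  assumes d: "d \<ge> 1" and \<beta>: "0 < \<beta>"
    and large: "\<And>k x. (k, x) \<in> F \<Longrightarrow> N < k"
    and fin: "\<And>k. finite {x. (k, x) \<in> F}"
    and card: "\<And>k. real (card {x. (k, x) \<in> F}) \<le> b k"
    and weight: "\<And>M. (\<Sum>k\<in>{N<..M}. real (k ^ d) * (b k / \<beta> ^ (k ^ d - 1))) \<le> 2 - \<beta>"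
  shows "avoidable d F"
proof -
  define I where "I = lattice_points d \<times> {N<..}"
  define C where "C = (\<lambda>(m, k). cube d m k)"
  define bad where "bad = (\<lambda>(m, k) f. (k, subcube d k f m) \<in> F)"
  have b_nonneg: "0 \<le> b k" for k using card[of k] by linarith
  have corner: "m \<in> cube d m k" if "(m, k) \<in> I" for m k
    using that by (auto simp: I_def lattice_points_def in_cube_iff)
  \<comment> \<open>This bound makes the constraints inside \<open>S\<close> finite in number and
    supplies the cut-off \<open>M = card S\<close> in the sum.\<close>
  have side: "k \<le> card S" if "(m, k) \<in> I" "finite S" "cube d m k \<subseteq> S" for m k S
  proof -
    have "k \<le> k ^ d" using that d by (intro self_le_power) (auto simp: I_def)
    also have "\<dots> = card (cube d m k)"
      using that by (simp add: I_def lattice_points_def card_cube)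
    also have "\<dots> \<le> card S" using that by (intro card_mono)
    finally show ?thesis .
  qed
  interpret local_constraints I C bad "\<lambda>(m, k). b k" \<beta>
  proof
    fix i assume i: "i \<in> I"
    obtain m k where [simp]: "i = (m, k)" by (cases i)
    show "finite (C i)" by (simp add: C_def finite_cube)
    show "C i \<noteq> {}" using corner i by (auto simp: C_def)
    show "bad i f \<longleftrightarrow> bad i g" if "\<And>v. v \<in> C i \<Longrightarrow> f v = g v" for f g
    proof -
      have "subcube d k f m = subcube d k g m"
        using that by (simp add: subcube_eq_iff C_def)
      then show ?thesis by (simp add: bad_def)
    qed
    have "inj_on (\<lambda>f. subcube d k f m) {f \<in> C i \<rightarrow>\<^sub>E UNIV. bad i f}"
      by (rule inj_onI) (auto simp: subcube_eq_iff C_def intro: PiE_ext)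
    moreover have "(\<lambda>f. subcube d k f m) ` {f \<in> C i \<rightarrow>\<^sub>E UNIV. bad i f} \<subseteq> {x. (k, x) \<in> F}"
      by (auto simp: bad_def)
    ultimately have "card {f \<in> C i \<rightarrow>\<^sub>E UNIV. bad i f} \<le> card {x. (k, x) \<in> F}"
      using fin by (intro card_inj_on_le)
    then show "real (card {f \<in> C i \<rightarrow>\<^sub>E UNIV. bad i f}) \<le> (case i of (m, k) \<Rightarrow> b k)"
      using card[of k] by simp
  next
    fix S :: "int list set" assume S: "finite S"
    have "{i \<in> I. C i \<subseteq> S} \<subseteq> S \<times> {..card S}"
      using corner side[OF _ S] by (fastforce simp: C_def)
    then show "finite {i \<in> I. C i \<subseteq> S}" using S by (auto intro: finite_subset)
    fix v assume "v \<in> S"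
    let ?w = "\<lambda>k. b k / \<beta> ^ (k ^ d - 1)"
    let ?m = "\<lambda>k. {m \<in> lattice_points d. v \<in> cube d m k}"
    have "(\<Sum>i | i \<in> I \<and> v \<in> C i \<and> C i \<subseteq> S. (case i of (m, k) \<Rightarrow> b k) / \<beta> ^ (card (C i) - 1))
        = (\<Sum>i | i \<in> I \<and> v \<in> C i \<and> C i \<subseteq> S. ?w (snd i))"
      by (rule sum.cong) (auto simp: I_def C_def lattice_points_def card_cube)
    \<comment> \<open>Inclusion in \<open>S\<close> is relaxed to the bound on the side, and
      swapping makes the side the outer summation index.\<close>
    also have "\<dots> \<le> (\<Sum>i \<in> prod.swap ` Sigma {N<..card S} ?m. ?w (snd i))"
    proof (rule sum_mono2)
      show "finite (prod.swap ` Sigma {N<..card S} ?m)"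
        using card_cubes_through by (intro finite_imageI finite_SigmaI) auto
      show "{i. i \<in> I \<and> v \<in> C i \<and> C i \<subseteq> S} \<subseteq> prod.swap ` Sigma {N<..card S} ?m"
        using side[OF _ S] by (fastforce simp: I_def C_def image_iff)
      show "0 \<le> ?w (snd i)" for i :: "int list \<times> nat"
        using b_nonneg \<beta> by simp
    qed
    also have "\<dots> = (\<Sum>(k, m) \<in> Sigma {N<..card S} ?m. ?w k)"
      by (subst sum.reindex) (auto simp: case_prod_unfold)
    also have "\<dots> = (\<Sum>k\<in>{N<..card S}. \<Sum>m\<in>?m k. ?w k)"
      using card_cubes_through by (subst sum.Sigma) auto
    also have "\<dots> = (\<Sum>k\<in>{N<..card S}. real (card (?m k)) * ?w k)" by simp
    also have "\<dots> \<le> (\<Sum>k\<in>{N<..card S}. real (k ^ d) * ?w k)"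
      using card_cubes_through b_nonneg \<beta> by (intro sum_mono mult_right_mono) (auto simp del: of_nat_power)
    also have "\<dots> \<le> 2 - \<beta>" by (rule weight)
    finally show "(\<Sum>i | i \<in> I \<and> v \<in> C i \<and> C i \<subseteq> S.
        (case i of (m, k) \<Rightarrow> b k) / \<beta> ^ (card (C i) - 1)) \<le> 2 - \<beta>" .
  qed (rule \<beta>)
  show ?thesis
    unfolding avoidable_def
  proof (intro allI impI)
    fix S :: "int list set" assume "finite S"
    from ex_sol[OF this] obtain f where f: "\<forall>i\<in>I. C i \<subseteq> S \<longrightarrow> \<not> bad i f" by blast
    have "avoids d F S f"
      unfolding avoids_def
    proof (intro ballI allI impI notI)
      fix m k assume m: "m \<in> lattice_points d" "cube d m k \<subseteq> S" "(k, subcube d k f m) \<in> F"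
      then have "(m, k) \<in> I" using large by (simp add: I_def)
      with f m show False by (auto simp: C_def bad_def)
    qed
    then show "\<exists>\<omega>. avoids d F S \<omega>" by blast
  qed
qed

section \<open>Choice of the growth rate and construction of the sequence\<close>

definition low_complexity_cubes ::
    "(bool list \<Rightarrow> bool list option) \<Rightarrow> nat \<Rightarrow> real \<Rightarrow> nat \<Rightarrow> (nat \<times> (nat list \<Rightarrow> bool)) set" where
  "low_complexity_cubes U d \<alpha> N = {(k, x). N < k \<and> x \<in> grid d k \<rightarrow>\<^sub>E UNIV \<and>
     ereal_of_enat (cube_complexity U d k x) < ereal (\<alpha> * real (k ^ d))}"

lemma avoidable_low_complexity_cubes:
  assumes d: "d \<ge> 1" and \<alpha>: "0 < \<alpha>" "\<alpha> < 1"
  shows "\<exists>N. avoidable d (low_complexity_cubes U d \<alpha> N)"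
proof -
  \<comment> \<open>\<gamma> is halfway between \<alpha> and 1: \<open>\<gamma> < 1\<close> leaves
    room \<open>2 - \<beta> > 0\<close>, and \<open>\<gamma> > \<alpha>\<close> gives
    \<open>c < 1\<close>, so the weights decay.\<close>
  define \<gamma> where "\<gamma> = (1 + \<alpha>) / 2"
  define \<beta> where "\<beta> = 2 powr \<gamma>"
  define c where "c = 2 powr (\<alpha> - \<gamma>)"
  define b where "b k = 2 * 2 powr (\<alpha> * real (k ^ d))" for k
  have \<beta>: "0 < \<beta>" "\<beta> < 2"
    using powr_less_mono[of \<gamma> 1 2] \<alpha> by (simp_all add: \<beta>_def \<gamma>_def)
  have c: "0 < c" "c < 1"
    using powr_less_mono[of "\<alpha> - \<gamma>" 0 2] \<alpha> by (simp_all add: c_def \<gamma>_def)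
  \<comment> \<open>A cube of side \<open>k\<close> will have weight
    \<open>2 * \<beta> * c ^ (k ^ d)\<close>, with 2 from the count of programs and \<beta> from the
    exponent \<open>k ^ d - 1\<close>; the allowed total is divided accordingly.\<close>
  obtain N where N: "\<And>M. (\<Sum>k\<in>{N<..M}. real (k ^ d) * c ^ (k ^ d)) \<le> (2 - \<beta>) / (2 * \<beta>)"
    using small_tail_of_power_sum[OF c d, of "(2 - \<beta>) / (2 * \<beta>)"] \<beta> by auto
  let ?F = "low_complexity_cubes U d \<alpha> N"
  have cubes: "finite {x. (k, x) \<in> ?F} \<and> real (card {x. (k, x) \<in> ?F}) \<le> b k" for k
  proof -
    let ?Y = "{y. ereal_of_enat (complexity U y) < ereal (\<alpha> * real (k ^ d))}"
    have Y: "finite ?Y" "real (card ?Y) \<le> b k"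
      unfolding b_def using low_complexity_finite_card[of "\<alpha> * real (k ^ d)" U] \<alpha> by auto
    have inj: "inj_on (cube_string d k) {x. (k, x) \<in> ?F}"
      by (rule inj_on_subset[OF inj_on_cube_string]) (auto simp: low_complexity_cubes_def)
    have sub: "cube_string d k ` {x. (k, x) \<in> ?F} \<subseteq> ?Y"
      by (auto simp: low_complexity_cubes_def cube_complexity_def)
    show ?thesis
      using inj_on_finite[OF inj sub Y(1)] card_inj_on_le[OF inj sub Y(1)] Y(2) by linarith
  qed
  have w: "b k / \<beta> ^ (k ^ d - 1) = 2 * \<beta> * c ^ (k ^ d)" if "k > 0" for k
  proof -
    have "\<beta> ^ (k ^ d) = \<beta> * \<beta> ^ (k ^ d - 1)"
      using that by (metis power_eq_if power_not_zero not_gr_zero)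
    moreover have "c ^ (k ^ d) * \<beta> ^ (k ^ d) = 2 powr (\<alpha> * real (k ^ d))"
    proof -
      have "c * \<beta> = 2 powr \<alpha>" by (simp add: c_def \<beta>_def flip: powr_add)
      then have "c ^ (k ^ d) * \<beta> ^ (k ^ d) = (2 powr \<alpha>) ^ (k ^ d)"
        by (simp flip: power_mult_distrib)
      also have "\<dots> = 2 powr (\<alpha> * real (k ^ d))"
        by (simp only: powr_powr[symmetric]) (rule powr_realpow[symmetric], simp)
      finally show ?thesis .
    qed
    ultimately show ?thesis using \<beta> by (simp add: b_def field_simps)
  qed
  have "avoidable d ?F"
  proof (rule few_patterns_avoidable[OF d \<beta>(1)])
    show "N < k" if "(k, x) \<in> ?F" for k x using that by (simp add: low_complexity_cubes_def)
    show "finite {x. (k, x) \<in> ?F}" and "real (card {x. (k, x) \<in> ?F}) \<le> b k" for k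
      using cubes by auto
    fix M
    have "(\<Sum>k\<in>{N<..M}. real (k ^ d) * (b k / \<beta> ^ (k ^ d - 1)))
        = (\<Sum>k\<in>{N<..M}. 2 * \<beta> * (real (k ^ d) * c ^ (k ^ d)))"
      by (rule sum.cong[OF refl]) (subst w, auto)
    also have "\<dots> = 2 * \<beta> * (\<Sum>k\<in>{N<..M}. real (k ^ d) * c ^ (k ^ d))"
      by (rule sum_distrib_left[symmetric])
    also have "\<dots> \<le> 2 * \<beta> * ((2 - \<beta>) / (2 * \<beta>))"
      using N \<beta> by (intro mult_left_mono) auto
    finally show "(\<Sum>k\<in>{N<..M}. real (k ^ d) * (b k / \<beta> ^ (k ^ d - 1))) \<le> 2 - \<beta>"
      using \<beta> by simp
  qed
  then show ?thesis ..
qed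

theorem proposition9:
  fixes d :: nat and \<alpha> :: real and U :: "bool list \<Rightarrow> bool list option"
  assumes "d \<ge> 1" and "0 < \<alpha>" and "\<alpha> < 1"
    and "optimal_machine U"
  shows "\<exists>\<omega> \<in> lattice_points d \<rightarrow>\<^sub>E (UNIV :: bool set).
    almost_periodic d \<omega> \<and>
    (\<exists>N::nat. \<forall>k>N. \<forall>m \<in> lattice_points d.
      ereal_of_enat (cube_complexity U d k (subcube d k \<omega> m)) \<ge> ereal (\<alpha> * real (k ^ d)))"
proof -
  obtain N where "avoidable d (low_complexity_cubes U d \<alpha> N)"
    using avoidable_low_complexity_cubes[OF assms(1-3)] by blast
  \<comment> \<open>Avoiding \<open>P\<close> serves both conclusions: \<open>P\<close> contains the
    low-complexity cubes, and its maximality gives almost periodicity.\<close>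
  from maximal_avoidable[OF this] obtain P where P: "low_complexity_cubes U d \<alpha> N \<subseteq> P"
    "avoidable d P" "\<And>q. q \<notin> P \<Longrightarrow> \<not> avoidable d (insert q P)" by blast
  obtain \<omega>' where \<omega>': "avoids d P UNIV \<omega>'" using avoidable_imp_avoids_UNIV[OF P(2)] by blast
  \<comment> \<open>Cubes at lattice points consist of lattice points, so restricting to the
    required domain changes no subcube.\<close>
  define \<omega> where "\<omega> = restrict \<omega>' (lattice_points d)"
  have "cube d m k \<subseteq> lattice_points d" if "m \<in> lattice_points d" for m k
    using that by (auto simp: lattice_points_def in_cube_iff)
  then have "subcube d k \<omega> m = subcube d k \<omega>' m" if "m \<in> lattice_points d" for m k
    using that by (auto simp: subcube_eq_iff \<omega>_def)
  with \<omega>' have \<omega>: "avoids d P UNIV \<omega>" unfolding avoids_def by simp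
  have "ereal (\<alpha> * real (k ^ d)) \<le> ereal_of_enat (cube_complexity U d k (subcube d k \<omega> m))"
    if "k > N" "m \<in> lattice_points d" for k m
  proof -
    have "(k, subcube d k \<omega> m) \<notin> low_complexity_cubes U d \<alpha> N"
      using \<omega> P(1) that unfolding avoids_def by blast
    moreover have "subcube d k \<omega> m \<in> grid d k \<rightarrow>\<^sub>E UNIV" by (simp add: subcube_def)
    ultimately show ?thesis using that by (simp add: low_complexity_cubes_def not_less)
  qed
  moreover have "almost_periodic d \<omega>" using \<omega> P(3) by (rule maximal_imp_almost_periodic)
  moreover have "\<omega> \<in> lattice_points d \<rightarrow>\<^sub>E UNIV" by (simp add: \<omega>_def)
  ultimately show ?thesis by blast
qed

end
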